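(* Let $(A,\cdot,[,],\alpha)$ be a Hom-Leibniz Poisson algebra, $(V,\lambda^l,\lambda^r,\rho^l,\rho^r,\phi)$ a representation of it, and $T:V\to A$ a linear map. Define $\widehat T\in \mathrm{End}(A\oplus V)$ by $\widehat T(a+v):=Tv$ for $a\in A$, $v\in V$. Then $T$ is a relative Rota-Baxter operator on $(A,\cdot,[,],\alpha)$ with respect to $(V,\lambda^l,\lambda^r,\rho^l,\rho^r,\phi)$ if and only if $\widehat T$ is a Rota-Baxter operator (of weight $0$) on the semi-direct product Hom-Leibniz Poisson algebra $A\oplus V$.
   Context: All vector spaces are over a field $\mathbb K$ of characteristic $0$; $gl(V)$ is the space of linear endomorphisms of $V$, and juxtaposition of operators is composition. A Hom-associative algebra $(A,\cdot,\alpha)$ is a vector space $A$ with a bilinear product and a linear map $\alpha:A\to A$ such that $\alpha(x\cdot y)=\alpha(x)\cdot\alpha(y)$ and $(x\cdot y)\cdot\alpha(z)=\alpha(x)\cdot(y\cdot z)$. A (right) Hom-Leibniz algebra $(A,[,],\alpha)$ is a vector space with a bilinear bracket and a linear map $\alpha$ such that $\alpha([x,y])=[\alpha(x),\alpha(y)]$ and $[[x,y],\alpha(z)]=[\alpha(x),[y,z]]+[[x,z],\alpha(y)]$. A Hom-Leibniz Poisson algebra $(A,\cdot,[,],\alpha)$ is such that $(A,\cdot,\alpha)$ is Hom-associative, $(A,[,],\alpha)$ is Hom-Leibniz, and $[x\cdot y,\alpha(z)]=\alpha(x)\cdot[y,z]+[x,z]\cdot\alpha(y)$ for all $x,y,z\in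 A$. A Rota-Baxter operator (of weight $0$) on a Hom-Leibniz Poisson algebra $(B,\cdot,[,],\beta)$ is a linear map $R:B\to B$ with $R\beta=\beta R$, $R(x)\cdot R(y)=R(R(x)\cdot y+x\cdot R(y))$ and $[R(x),R(y)]=R([R(x),y]+[x,R(y)])$ for all $x,y\in B$ (that is, a relative Rota-Baxter operator with respect to the regular representation). A representation of a Hom-associative algebra $(A,\cdot,\alpha)$ is $(V,\lambda^l,\lambda^r,\phi)$ with $V$ a vector space, $\phi\in gl(V)$, and $\lambda^l,\lambda^r:A\to gl(V)$ linear such that for all $x,y\in A$: $\phi\lambda^l(x)=\lambda^l(\alpha(x))\phi$; $\phi\lambda^r(x)=\lambda^r(\alpha(x))\phi$; $\lambda^l(x\cdot y)\phi=\lambda^l(\alpha(x))\lambda^l(y)$; $\lambda^r(x\cdot y)\phi=\lambda^r(\alpha(y))\lambda^r(x)$; $\lambda^l(\alpha(x))\lambda^r(y)=\lambda^r(\alpha(y))\lambda^l(x)$. A representation of a Hom-Leibniz algebra $(A,[,],\alpha)$ is $(V,\rho^l,\rho^r,\phi)$ with $\phi\in gl(V)$ and $\rho^l,\rho^r:A\to gl(V)$ linear such that for all $x,y\in A$: $\rho^l(\alpha(x))\phi=\phi\rho^l(x)$; $\rho^r(\alpha(x))\phi=\phi\rho^r(x)$; $\rho^l([x,y])\phi=\rho^l(\alpha(x))\rho^l(y)+\rho^r(\alpha(y))\rho^l(x)$; $\rho^r(\alpha(y))\rho^l(x)=\rho^l(\alpha(x))\rho^r(y)+\rho^l([x,y])\phi$;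 $\rho^r(\alpha(y))\rho^r(x)=\rho^r([x,y])\phi+\rho^r(\alpha(x))\rho^r(y)$. A representation of a Hom-Leibniz Poisson algebra $(A,\cdot,[,],\alpha)$ is $(V,\lambda^l,\lambda^r,\rho^l,\rho^r,\phi)$ such that $(V,\lambda^l,\lambda^r,\phi)$ is a representation of $(A,\cdot,\alpha)$, $(V,\rho^l,\rho^r,\phi)$ is a representation of $(A,[,],\alpha)$, and for all $x,y\in A$: $\rho^r(\alpha(y))\lambda^l(x)=\lambda^l(\alpha(x))\rho^r(y)+\lambda^l([x,y])\phi$; $\rho^r(\alpha(y))\lambda^r(x)=\lambda^r([x,y])\phi+\lambda^r(\alpha(x))\rho^r(y)$; $\rho^l(x\cdot y)\phi=\lambda^l(\alpha(x))\rho^l(y)+\lambda^r(\alpha(y))\rho^l(x)$. The semi-direct product is the Hom-Leibniz Poisson algebra $(A\oplus V,\ast,\{,\},\alpha\oplus\phi)$ with $(x+u)\ast(y+v)=x\cdot y+\lambda^l(x)v+\lambda^r(y)u$, $\{x+u,y+v\}=[x,y]+\rho^l(x)v+\rho^r(y)u$, $(\alpha\oplus\phi)(x+u)=\alpha(x)+\phi(u)$. A relative Rota-Baxter operator on $(A,\cdot,[,],\alpha)$ with respect to $(V,\lambda^l,\lambda^r,\rho^l,\rho^r,\phi)$ is a linear map $T:V\to A$ with $T\phi=\alpha T$, $Tu\cdot Tv=T(\lambda^l(Tu)v+\lambda^r(Tv)u)$ and $[Tu,Tv]=T(\rho^l(Tu)v+\rho^r(Tv)u)$ for all $u,v\in V$.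 *)

theory Defs
  imports "HOL-Analysis.Product_Vector"
begin

text \<open>
  A vector space over \<open>'k\<close> is a type of class \<open>ab_group_add\<close> together with a scalar
  multiplication satisfying the library locale \<^locale>\<open>vector_space\<close>.
  The direct sum \<open>A \<oplus> V\<close> is the product type with scalar multiplication
  \<^const>\<open>module_prod.scale\<close>; the element \<open>a + v\<close> of the direct sum is the pair \<open>(a, v)\<close>.
\<close>

text \<open>
  With \<open>X = Y = Z\<close> this is bilinearity of a product.  With \<open>Y = Z = V\<close> it says that
  \<open>f\<close> is a linear map \<open>X \<rightarrow> gl(V)\<close>: every \<open>f x\<close> is a linear endomorphism of \<open>V\<close>, and
  \<open>f\<close> is linear for the pointwise vector space structure on \<open>gl(V)\<close>.
\<close>

definition bilinear_map ::
  "('k::field_char_0 \<Rightarrow> 'x::ab_group_add \<Rightarrow> 'x) \<Rightarrow> ('k \<Rightarrow> 'y::ab_group_add \<Rightarrow> 'y) \<Rightarrow>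
   ('k \<Rightarrow> 'z::ab_group_add \<Rightarrow> 'z) \<Rightarrow> ('x \<Rightarrow> 'y \<Rightarrow> 'z) \<Rightarrow> bool"
  where "bilinear_map sX sY sZ f \<longleftrightarrow>
    (\<forall>x. Vector_Spaces.linear sY sZ (f x)) \<and> (\<forall>y. Vector_Spaces.linear sX sZ (\<lambda>x. f x y))"

locale hom_associative_algebra =
  fixes s :: "'k::field_char_0 \<Rightarrow> 'a::ab_group_add \<Rightarrow> 'a"
    and mul :: "'a \<Rightarrow> 'a \<Rightarrow> 'a"
    and \<alpha> :: "'a \<Rightarrow> 'a"
  assumes mul_bilinear: "bilinear_map s s s mul"
    and mul_twist_linear: "Vector_Spaces.linear s s \<alpha>"
    and mul_multiplicative: "\<alpha> (mul x y) = mul (\<alpha> x) (\<alpha> y)"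
    and hom_assoc: "mul (mul x y) (\<alpha> z) = mul (\<alpha> x) (mul y z)"

locale hom_leibniz_algebra =
  fixes s :: "'k::field_char_0 \<Rightarrow> 'a::ab_group_add \<Rightarrow> 'a"
    and br :: "'a \<Rightarrow> 'a \<Rightarrow> 'a"
    and \<alpha> :: "'a \<Rightarrow> 'a"
  assumes br_bilinear: "bilinear_map s s s br"
    and br_twist_linear: "Vector_Spaces.linear s s \<alpha>"
    and br_multiplicative: "\<alpha> (br x y) = br (\<alpha> x) (\<alpha> y)"
    and hom_leibniz: "br (br x y) (\<alpha> z) = br (\<alpha> x) (br y z) + br (br x z) (\<alpha> y)"

locale hom_leibniz_poisson_algebra =
  hom_associative_algebra s mul \<alpha> + hom_leibniz_algebra s br \<alpha>
  for s :: "'k::field_char_0 \<Rightarrow> 'a::ab_group_add \<Rightarrow> 'a"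
    and mul :: "'a \<Rightarrow> 'a \<Rightarrow> 'a"
    and br :: "'a \<Rightarrow> 'a \<Rightarrow> 'a"
    and \<alpha> :: "'a \<Rightarrow> 'a" +
  assumes hom_poisson: "br (mul x y) (\<alpha> z) = mul (\<alpha> x) (br y z) + mul (br x z) (\<alpha> y)"

text \<open>Identities between operators on \<open>V\<close> are stated pointwise in \<open>v\<close>.\<close>

locale hom_associative_representation =
  hom_associative_algebra sA mul \<alpha>
  for sA :: "'k::field_char_0 \<Rightarrow> 'a::ab_group_add \<Rightarrow> 'a"
    and mul :: "'a \<Rightarrow> 'a \<Rightarrow> 'a"
    and \<alpha> :: "'a \<Rightarrow> 'a" +
  fixes sV :: "'k \<Rightarrow> 'v::ab_group_add \<Rightarrow> 'v"
    and laml :: "'a \<Rightarrow> 'v \<Rightarrow> 'v"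
    and lamr :: "'a \<Rightarrow> 'v \<Rightarrow> 'v"
    and \<phi> :: "'v \<Rightarrow> 'v"
  assumes assoc_phi_linear: "Vector_Spaces.linear sV sV \<phi>"
    and lam_l_linear: "bilinear_map sA sV sV laml"
    and lam_r_linear: "bilinear_map sA sV sV lamr"
    and phi_lam_l: "\<phi> (laml x v) = laml (\<alpha> x) (\<phi> v)"
    and phi_lam_r: "\<phi> (lamr x v) = lamr (\<alpha> x) (\<phi> v)"
    and lam_l_mul: "laml (mul x y) (\<phi> v) = laml (\<alpha> x) (laml y v)"
    and lam_r_mul: "lamr (mul x y) (\<phi> v) = lamr (\<alpha> y) (lamr x v)"
    and lam_l_lam_r: "laml (\<alpha> x) (lamr y v) = lamr (\<alpha> y) (laml x v)"

locale hom_leibniz_representation =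
  hom_leibniz_algebra sA br \<alpha>
  for sA :: "'k::field_char_0 \<Rightarrow> 'a::ab_group_add \<Rightarrow> 'a"
    and br :: "'a \<Rightarrow> 'a \<Rightarrow> 'a"
    and \<alpha> :: "'a \<Rightarrow> 'a" +
  fixes sV :: "'k \<Rightarrow> 'v::ab_group_add \<Rightarrow> 'v"
    and rhol :: "'a \<Rightarrow> 'v \<Rightarrow> 'v"
    and rhor :: "'a \<Rightarrow> 'v \<Rightarrow> 'v"
    and \<phi> :: "'v \<Rightarrow> 'v"
  assumes leibniz_phi_linear: "Vector_Spaces.linear sV sV \<phi>"
    and rho_l_linear: "bilinear_map sA sV sV rhol"
    and rho_r_linear: "bilinear_map sA sV sV rhor"
    and rho_l_phi: "rhol (\<alpha> x) (\<phi> v) = \<phi> (rhol x v)"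
    and rho_r_phi: "rhor (\<alpha> x) (\<phi> v) = \<phi> (rhor x v)"
    and rho_l_br: "rhol (br x y) (\<phi> v) = rhol (\<alpha> x) (rhol y v) + rhor (\<alpha> y) (rhol x v)"
    and rho_r_rho_l: "rhor (\<alpha> y) (rhol x v) = rhol (\<alpha> x) (rhor y v) + rhol (br x y) (\<phi> v)"
    and rho_r_rho_r: "rhor (\<alpha> y) (rhor x v) = rhor (br x y) (\<phi> v) + rhor (\<alpha> x) (rhor y v)"

locale hom_leibniz_poisson_representation =
  hom_leibniz_poisson_algebra sA mul br \<alpha> +
  hom_associative_representation sA mul \<alpha> sV laml lamr \<phi> +
  hom_leibniz_representation sA br \<alpha> sV rhol rhor \<phi>
  for sA :: "'k::field_char_0 \<Rightarrow> 'a::ab_group_add \<Rightarrow> 'a"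
    and mul :: "'a \<Rightarrow> 'a \<Rightarrow> 'a"
    and br :: "'a \<Rightarrow> 'a \<Rightarrow> 'a"
    and \<alpha> :: "'a \<Rightarrow> 'a"
    and sV :: "'k \<Rightarrow> 'v::ab_group_add \<Rightarrow> 'v"
    and laml :: "'a \<Rightarrow> 'v \<Rightarrow> 'v"
    and lamr :: "'a \<Rightarrow> 'v \<Rightarrow> 'v"
    and rhol :: "'a \<Rightarrow> 'v \<Rightarrow> 'v"
    and rhor :: "'a \<Rightarrow> 'v \<Rightarrow> 'v"
    and \<phi> :: "'v \<Rightarrow> 'v" +
  assumes rho_r_lam_l: "rhor (\<alpha> y) (laml x v) = laml (\<alpha> x) (rhor y v) + laml (br x y) (\<phi> v)"
    and rho_r_lam_r: "rhor (\<alpha> y) (lamr x v) = lamr (br x y) (\<phi> v) + lamr (\<alpha> x) (rhor y v)"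
    and rho_l_mul: "rhol (mul x y) (\<phi> v) = laml (\<alpha> x) (rhol y v) + lamr (\<alpha> y) (rhol x v)"

locale relative_rota_baxter_operator =
  hom_leibniz_poisson_representation sA mul br \<alpha> sV laml lamr rhol rhor \<phi>
  for sA :: "'k::field_char_0 \<Rightarrow> 'a::ab_group_add \<Rightarrow> 'a"
    and mul :: "'a \<Rightarrow> 'a \<Rightarrow> 'a"
    and br :: "'a \<Rightarrow> 'a \<Rightarrow> 'a"
    and \<alpha> :: "'a \<Rightarrow> 'a"
    and sV :: "'k \<Rightarrow> 'v::ab_group_add \<Rightarrow> 'v"
    and laml :: "'a \<Rightarrow> 'v \<Rightarrow> 'v"
    and lamr :: "'a \<Rightarrow> 'v \<Rightarrow> 'v"
    and rhol :: "'a \<Rightarrow> 'v \<Rightarrow> 'v"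
    and rhor :: "'a \<Rightarrow> 'v \<Rightarrow> 'v"
    and \<phi> :: "'v \<Rightarrow> 'v" +
  fixes T :: "'v \<Rightarrow> 'a"
  assumes T_linear: "Vector_Spaces.linear sV sA T"
    and T_phi: "T (\<phi> u) = \<alpha> (T u)"
    and T_mul: "mul (T u) (T v) = T (laml (T u) v + lamr (T v) u)"
    and T_br: "br (T u) (T v) = T (rhol (T u) v + rhor (T v) u)"

locale rota_baxter_operator =
  hom_leibniz_poisson_algebra s mul br \<beta>
  for s :: "'k::field_char_0 \<Rightarrow> 'b::ab_group_add \<Rightarrow> 'b"
    and mul :: "'b \<Rightarrow> 'b \<Rightarrow> 'b"
    and br :: "'b \<Rightarrow> 'b \<Rightarrow> 'b"
    and \<beta> :: "'b \<Rightarrow> 'b" +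
  fixes R :: "'b \<Rightarrow> 'b"
  assumes R_linear: "Vector_Spaces.linear s s R"
    and R_beta: "R (\<beta> x) = \<beta> (R x)"
    and R_mul: "mul (R x) (R y) = R (mul (R x) y + mul x (R y))"
    and R_br: "br (R x) (R y) = R (br (R x) y + br x (R y))"

text \<open>
  Both products \<open>\<ast>\<close> and \<open>{,}\<close> of the semi-direct product are instances of this operation;
  its twist \<open>\<alpha> \<oplus> \<phi>\<close> is \<^term>\<open>map_prod \<alpha> \<phi>\<close>.
\<close>

definition semidirect ::
  "('a \<Rightarrow> 'a \<Rightarrow> 'a) \<Rightarrow> ('a \<Rightarrow> 'v \<Rightarrow> 'v) \<Rightarrow> ('a \<Rightarrow> 'v \<Rightarrow> 'v::ab_group_add) \<Rightarrow>
   'a \<times> 'v \<Rightarrow> 'a \<times> 'v \<Rightarrow> 'a \<times> 'v"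
  where "semidirect m l r p q =
    (m (fst p) (fst q), l (fst p) (snd q) + r (fst q) (snd p))"

definition hat :: "('v \<Rightarrow> 'a) \<Rightarrow> 'a \<times> 'v \<Rightarrow> 'a \<times> 'v::ab_group_add"
  where "hat T p = (T (snd p), 0)"

context hom_leibniz_poisson_representation
begin

lemma semidirect_bilinear:
  assumes "bilinear_map sA sA sA m" "bilinear_map sA sV sV l" "bilinear_map sA sV sV r"
  shows "bilinear_map (module_prod.scale sA sV) (module_prod.scale sA sV)
    (module_prod.scale sA sV) (semidirect m l r)"
proof -
  interpret A: Vector_Spaces.linear sA sA \<alpha> by (rule mul_twist_linear)
  interpret V: Vector_Spaces.linear sV sV \<phi> by (rule assoc_phi_linear)
  interpret AV: vector_space_prod sA sV by unfold_locales
  show ?thesis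
    using assms
    unfolding bilinear_map_def module_hom_iff_linear[symmetric] module_hom_iff
    by (auto simp: semidirect_def AV.scale_def AV.p.module_axioms algebra_simps)
qed

theorem semidirect_hom_leibniz_poisson_algebra:
  "hom_leibniz_poisson_algebra (module_prod.scale sA sV)
    (semidirect mul laml lamr) (semidirect br rhol rhor) (map_prod \<alpha> \<phi>)"
proof -
  interpret \<alpha>: Vector_Spaces.linear sA sA \<alpha> by (rule mul_twist_linear)
  interpret \<phi>: Vector_Spaces.linear sV sV \<phi> by (rule assoc_phi_linear)
  interpret AV: vector_space_prod sA sV by unfold_locales
  have l_add: "laml x (u + v) = laml x u + laml x v" for x u v
    using lam_l_linear by (simp add: bilinear_map_def module_hom_iff_linear[symmetric] module_hom_iff)
  have r_add: "lamr x (u + v) = lamr x u + lamr x v" for x u v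
    using lam_r_linear by (simp add: bilinear_map_def module_hom_iff_linear[symmetric] module_hom_iff)
  have rl_add: "rhol x (u + v) = rhol x u + rhol x v" for x u v
    using rho_l_linear by (simp add: bilinear_map_def module_hom_iff_linear[symmetric] module_hom_iff)
  have rr_add: "rhor x (u + v) = rhor x u + rhor x v" for x u v
    using rho_r_linear by (simp add: bilinear_map_def module_hom_iff_linear[symmetric] module_hom_iff)
  note adds = l_add r_add rl_add rr_add
  have tw: "Vector_Spaces.linear (module_prod.scale sA sV) (module_prod.scale sA sV) (map_prod \<alpha> \<phi>)"
    unfolding module_hom_iff_linear[symmetric] module_hom_iff
    by (auto simp: AV.scale_def AV.p.module_axioms prod_eq_iff \<alpha>.add \<phi>.add \<alpha>.scale \<phi>.scale)
  show ?thesis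
  proof (intro hom_leibniz_poisson_algebra.intro hom_associative_algebra.intro
      hom_leibniz_algebra.intro hom_leibniz_poisson_algebra_axioms.intro, goal_cases)
    case 1
    show ?case by (rule semidirect_bilinear[OF mul_bilinear lam_l_linear lam_r_linear])
  next
    case 2
    show ?case by (rule tw)
  next
    case (3 x y)
    show ?case by (simp add: semidirect_def prod_eq_iff mul_multiplicative phi_lam_l phi_lam_r \<phi>.add)
  next
    case (4 x y z)
    show ?case
      by (simp add: semidirect_def prod_eq_iff adds hom_assoc lam_l_mul lam_r_mul lam_l_lam_r)
  next
    case 5
    show ?case by (rule semidirect_bilinear[OF br_bilinear rho_l_linear rho_r_linear])
  next
    case 6
    show ?case by (rule tw)
  next
    case (7 x y)
    show ?case
      by (simp add: semidirect_def prod_eq_iff br_multiplicative rho_l_phi rho_r_phi \<phi>.add)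
  next
    case (8 x y z)
    show ?case
      by (simp add: semidirect_def prod_eq_iff adds
          hom_leibniz[of "fst x" "fst y" "fst z"] rho_r_rho_r[of "fst z" "fst y" "snd x"]
          rho_r_rho_l[of "fst z" "fst x" "snd y"] rho_l_br[of "fst x" "fst y" "snd z"] algebra_simps)
  next
    case (9 x y z)
    show ?case
      by (simp add: semidirect_def prod_eq_iff adds hom_poisson rho_r_lam_l rho_r_lam_r
          rho_l_mul algebra_simps)
  qed
qed

end

end

theory Submission
  imports Defs
begin

text \<open>\<open>hat T\<close> maps into A and depends only on the V-component. For p = a + u and
  q = b + v, the product of their images is thus the product of Tu and Tv in A, while
  \<open>hat T\<close> of the mixed sum applies T to l(Tu)v + r(Tv)u and discards the A-part, the
  only place where a and b occur. So each Rota-Baxter identity for \<open>hat T\<close> is the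
  relative identity for T. \<open>hat_semidirect_iff\<close> proves this for generic m, l, r, so
  that it serves both products.\<close>

lemma bilinear_map_zero_right:
  assumes "bilinear_map sX sY sZ f"
  shows "f x 0 = 0"
  using assms unfolding bilinear_map_def module_hom_iff_linear[symmetric]
  by (blast intro: module_hom.zero)

text \<open>On images of \<^term>\<open>hat T\<close> the module components vanish, and \<^term>\<open>hat T\<close> ignores the
  algebra components, so only the relative identity survives.\<close>

lemma hat_semidirect_iff:
  assumes "bilinear_map sX sV sV l" "bilinear_map sX sV sV r"
  shows "(\<forall>p q. semidirect m l r (hat T p) (hat T q) =
      hat T (semidirect m l r (hat T p) q + semidirect m l r p (hat T q)))
    \<longleftrightarrow> (\<forall>u v. m (T u) (T v) = T (l (T u) v + r (T v) u))"
  using assms[THEN bilinear_map_zero_right] by (auto simp: semidirect_def hat_def)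

lemma linear_hat:
  assumes "Vector_Spaces.linear sV sA T"
  shows "Vector_Spaces.linear (module_prod.scale sA sV) (module_prod.scale sA sV) (hat T)"
proof -
  interpret T: Vector_Spaces.linear sV sA T by (rule assms)
  interpret AV: vector_space_prod sA sV by unfold_locales
  show ?thesis
    unfolding module_hom_iff_linear[symmetric] module_hom_iff
    by (auto simp: hat_def AV.scale_def AV.p.module_axioms T.add T.scale)
qed

theorem proposition4p13:
  fixes sA :: "'k::field_char_0 \<Rightarrow> 'a::ab_group_add \<Rightarrow> 'a"
    and mul br :: "'a \<Rightarrow> 'a \<Rightarrow> 'a"
    and \<alpha> :: "'a \<Rightarrow> 'a"
    and sV :: "'k \<Rightarrow> 'v::ab_group_add \<Rightarrow> 'v"
    and laml lamr rhol rhor :: "'a \<Rightarrow> 'v \<Rightarrow> 'v"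
    and \<phi> :: "'v \<Rightarrow> 'v"
    and T :: "'v \<Rightarrow> 'a"
  assumes "hom_leibniz_poisson_algebra sA mul br \<alpha>"
    and "hom_leibniz_poisson_representation sA mul br \<alpha> sV laml lamr rhol rhor \<phi>"
    and "Vector_Spaces.linear sV sA T"
  shows "relative_rota_baxter_operator sA mul br \<alpha> sV laml lamr rhol rhor \<phi> T \<longleftrightarrow>
    rota_baxter_operator (module_prod.scale sA sV)
      (semidirect mul laml lamr) (semidirect br rhol rhor) (map_prod \<alpha> \<phi>) (hat T)"
proof -
  interpret hom_leibniz_poisson_representation sA mul br \<alpha> sV laml lamr rhol rhor \<phi>
    by (rule assms(2))
  interpret \<phi>: Vector_Spaces.linear sV sV \<phi> by (rule assoc_phi_linear)
  \<comment> \<open>At p = a + u the A-components give T(\<phi> u) = \<alpha>(T u); the V-components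
    agree because \<phi> 0 = 0.\<close>
  have "(\<forall>p. hat T (map_prod \<alpha> \<phi> p) = map_prod \<alpha> \<phi> (hat T p)) \<longleftrightarrow>
      (\<forall>u. T (\<phi> u) = \<alpha> (T u))"
    by (simp add: hat_def \<phi>.zero)
  \<comment> \<open>The representation, the semi-direct product algebra and both linearity
    conditions hold outright, so the two locale predicates reduce to three identities each, which
    match one by one.\<close>
  then show ?thesis
    using assms(2,3) semidirect_hom_leibniz_poisson_algebra linear_hat[OF assms(3)]
      hat_semidirect_iff[OF lam_l_linear lam_r_linear, of mul T]
      hat_semidirect_iff[OF rho_l_linear rho_r_linear, of br T]
    by (simp add: relative_rota_baxter_operator_def relative_rota_baxter_operator_axioms_def
        rota_baxter_operator_def rota_baxter_operator_axioms_def)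
qed

end
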